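(* Let $f$ be defined on $[0,+\infty)$ by $f(x)=\dfrac{1}{1+2\lfloor x\rfloor-x}$. Then the sequence $(t_n)_{n\geqslant 0}$ satisfies $t_0=0$ and, for every integer $n\geqslant 1$, $$t_n=\frac{1}{2\,(1+2\lfloor t_{n-1}\rfloor-t_{n-1})}=\frac{f(t_{n-1})}{2}.$$
   Context: $\lfloor x\rfloor$ denotes the integral part of $x$. Define triples of integers $N_n=(a_n;b_n;c_n)$ for every integer $n\geqslant 1$ as the labels of the vertices of a ternary tree $\mathcal{A}_3$ read from the top and, at each level, from left to right. The top is $N_1=(1;2;0)$. For every $n\geqslant 1$, the left, middle and right children of $N_n=(a;b;c)$ are respectively $N_{3n-1}$, $N_{3n}$, $N_{3n+1}$, and they are given by: - if $b$ is odd: $N_{3n-1}=(4(c+1)a-b;\,2a;\,0)$, $N_{3n}=(a;\,2a+b;\,c+1)$, $N_{3n+1}=(2a+b;\,2a+2b;\,0)$; - if $b$ is even: $N_{3n-1}=(2(c+1)a-\frac{b}{2};\,a;\,0)$, $N_{3n}=(a;\,2a+b;\,c+1)$, $N_{3n+1}=(a+\frac{b}{2};\,a+b;\,0)$. The sequence $(t_n)_{n\geqslant 0}$ is defined by $t_0=0$ and $t_n=\frac{a_n}{b_n}$ for every $n\geqslant 1$. *)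

theory Defs
  imports Complex_Main
begin

type_synonym triple = "int \<times> int \<times> int"

fun left_child :: "triple \<Rightarrow> triple" where
  "left_child (a, b, c) =
     (if odd b then (4 * (c + 1) * a - b, 2 * a, 0)
      else (2 * (c + 1) * a - b div 2, a, 0))"

fun middle_child :: "triple \<Rightarrow> triple" where
  "middle_child (a, b, c) = (a, 2 * a + b, c + 1)"

fun right_child :: "triple \<Rightarrow> triple" where
  "right_child (a, b, c) =
     (if odd b then (2 * a + b, 2 * a + 2 * b, 0)
      else (a + b div 2, a + b, 0))"

text \<open>
  The children of vertex \<open>n \<ge> 1\<close> carry the numbers \<open>3 n - 1\<close>, \<open>3 n\<close>, \<open>3 n + 1\<close>, so the
  parent of vertex \<open>m \<ge> 2\<close> is \<open>(m + 1) div 3\<close>, and the residue of \<open>m\<close> modulo 3 tells which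
  child it is. There is no vertex 0.
\<close>

fun N :: "nat \<Rightarrow> triple" where
  "N m =
     (if m = 0 then undefined
      else if m = 1 then (1, 2, 0)
      else if m mod 3 = 2 then left_child (N ((m + 1) div 3))
      else if m mod 3 = 0 then middle_child (N ((m + 1) div 3))
      else right_child (N ((m + 1) div 3)))"

declare N.simps [simp del]

lemma N_1: "N 1 = (1, 2, 0)"
  by (simp add: N.simps)

lemma N_left:
  assumes "n \<ge> 1" shows "N (3 * n - 1) = left_child (N n)"
proof -
  obtain k where k: "n = Suc k" using assms by (cases n) auto
  have m: "3 * n - 1 = 3 * k + 2" and "(3 * k + 2) mod 3 = 2" "(3 * k + 2 + 1) div 3 = n"
    using k by presburger+
  then show ?thesis unfolding m by (subst N.simps) simp
qed

lemma N_middle: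
  assumes "n \<ge> 1" shows "N (3 * n) = middle_child (N n)"
proof -
  have "3 * n mod 3 = 0" "(3 * n + 1) div 3 = n" "3 * n \<noteq> 1" by presburger+
  then show ?thesis using assms by (subst N.simps) simp
qed

lemma N_right:
  assumes "n \<ge> 1" shows "N (3 * n + 1) = right_child (N n)"
proof -
  have "(3 * n + 1) mod 3 = 1" "(3 * n + 1 + 1) div 3 = n" by presburger+
  then show ?thesis using assms by (subst N.simps) simp
qed

definition a_seq :: "nat \<Rightarrow> int" where "a_seq n = fst (N n)"
definition b_seq :: "nat \<Rightarrow> int" where "b_seq n = fst (snd (N n))"
definition c_seq :: "nat \<Rightarrow> int" where "c_seq n = snd (snd (N n))"

definition t :: "nat \<Rightarrow> real" where
  "t n = (if n = 0 then 0 else real_of_int (a_seq n) / real_of_int (b_seq n))"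

end

theory Submission
  imports Defs
begin

text \<open>
  Write \<open>g x = 1 / (2 * (1 + 2 * \<lfloor>x\<rfloor> - x))\<close>; the claim is that \<open>t\<close> is the orbit of \<open>0\<close> under \<open>g\<close>.
  The parity of \<open>b\<close> only decides whether a common factor is cancelled, so in terms of the
  ratios alone the children of \<open>n\<close> are
    \<open>t (3 n - 1) = 2 (c + 1) - 1 / (2 t n)\<close>,
    \<open>t (3 n) = t n / (2 t n + 1)\<close> and
    \<open>t (3 n + 1) = (2 t n + 1) / (2 (t n + 1))\<close>.
  The third label is determined by the ratio: \<open>c + 1\<close> is the ceiling of \<open>1 / (2 t n)\<close>
  (\<open>N_invariant\<close>, \<open>c_seq_bounds\<close>).

  Between siblings \<open>g\<close> acts correctly by a direct computation: the left child lies in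
  \<open>[c + 1, c + 2)\<close>, so that its floor is \<open>c + 1\<close>, and the middle child lies in \<open>(0, 1/2)\<close>.
  Apart from \<open>g 0 = 1/2\<close>, the only other step goes from the right child of \<open>k\<close> to the left
  child of \<open>k + 1\<close>, where the top counts as the right child of a vertex \<open>0\<close>.  Here
  \<open>g\<close> sends \<open>t (3 k + 1)\<close> to \<open>t k + 1\<close>, and the left child of \<open>k + 1\<close> has this value provided that
  \<open>t (k + 1) = g (t k)\<close> and \<open>c\<close> at \<open>k + 1\<close> is \<open>\<lfloor>t k\<rfloor>\<close>.  The second condition follows from the
  first and the ceiling property, so strong induction on the index closes the argument.
\<close>

lemma ternary_tree_induct [consumes 1, case_names top left middle right]:
  assumes "n \<ge> 1"
    and "P 1"
    and "\<And>k. k \<ge> 1 \<Longrightarrow> P k \<Longrightarrow> P (3 * k - 1)"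
    and "\<And>k. k \<ge> 1 \<Longrightarrow> P k \<Longrightarrow> P (3 * k)"
    and "\<And>k. k \<ge> 1 \<Longrightarrow> P k \<Longrightarrow> P (3 * k + 1)"
  shows "P (n :: nat)"
  using assms(1)
proof (induction n rule: less_induct)
  case (less n)
  show ?case
  proof (cases "n = 1")
    case True
    then show ?thesis using assms(2) by simp
  next
    case False
    define k where "k = (n + 1) div 3"
    have k: "1 \<le> k" "k < n" and n: "n = 3 * k - 1 \<or> n = 3 * k \<or> n = 3 * k + 1"
      using less.prems False unfolding k_def by presburger+
    show ?thesis
      using n assms(3-5)[OF k(1) less.IH[OF k(2,1)]] by metis
  qed
qed

text \<open>
  In integers, \<open>c < b / (2 a) \<le> c + 1\<close>.  The middle child raises \<open>b / (2 a)\<close> by exactly one; at the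
  left and right children, where \<open>c\<close> restarts from \<open>0\<close>, the ratio \<open>a / b\<close> is at least \<open>1/2\<close>.
\<close>

lemma N_invariant:
  assumes "n \<ge> 1"
  shows "case N n of (a, b, c) \<Rightarrow> 0 < a \<and> 0 < b \<and> 0 \<le> c \<and> 2 * a * c < b \<and> b \<le> 2 * a * (c + 1)"
  using assms
proof (induction n rule: ternary_tree_induct)
  case top
  show ?case unfolding N_1 by simp
next
  case (left k)
  obtain a b c where N: "N k = (a, b, c)" by (cases "N k")
  have inv: "0 < a" "0 < b" "0 \<le> c" "b \<le> 2 * (a * c) + 2 * a"
    using left(2) by (auto simp: N algebra_simps)
  have "0 \<le> a * c" using inv by simp
  then have "b \<le> 3 * a + 4 * (a * c)" using inv by linarith
  with inv show ?case
    unfolding N_left[OF left(1)] N by (auto simp: algebra_simps elim!: evenE)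
next
  case (middle k)
  obtain a b c where N: "N k = (a, b, c)" by (cases "N k")
  show ?case
    using middle(2) unfolding N_middle[OF middle(1)] N by (simp add: algebra_simps)
next
  case (right k)
  obtain a b c where N: "N k = (a, b, c)" by (cases "N k")
  show ?case
    using right(2) unfolding N_right[OF right(1)] N by (auto elim!: evenE)
qed

lemma seq_invariant:
  assumes "n \<ge> 1"
  shows "0 < a_seq n" "0 < b_seq n" "2 * a_seq n * c_seq n < b_seq n"
    "b_seq n \<le> 2 * a_seq n * (c_seq n + 1)"
  using N_invariant[OF assms] by (simp_all add: a_seq_def b_seq_def c_seq_def split_beta)

lemma t_pos: "n \<ge> 1 \<Longrightarrow> 0 < t n"
  using seq_invariant[of n] by (simp add: t_def)

lemma t_nonneg: "0 \<le> t n"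
  using t_pos[of n] by (cases "n = 0") (simp_all add: t_def)

lemma c_seq_bounds:
  assumes "n \<ge> 1"
  shows "real_of_int (c_seq n) < 1 / (2 * t n)" "1 / (2 * t n) \<le> real_of_int (c_seq n) + 1"
proof -
  note inv = seq_invariant[OF assms]
  have inverse_t: "1 / (2 * t n) = real_of_int (b_seq n) / (2 * real_of_int (a_seq n))"
    using assms by (simp add: t_def)
  have "real_of_int (2 * a_seq n * c_seq n) < real_of_int (b_seq n)"
    "real_of_int (b_seq n) \<le> real_of_int (2 * a_seq n * (c_seq n + 1))"
    using inv by (simp_all only: of_int_less_iff of_int_le_iff)
  then show "real_of_int (c_seq n) < 1 / (2 * t n)"
    "1 / (2 * t n) \<le> real_of_int (c_seq n) + 1"
    using inv(1) unfolding inverse_t by (simp_all add: field_simps)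
qed

lemma t_left:
  assumes "n \<ge> 1"
  shows "t (3 * n - 1) = 2 * (real_of_int (c_seq n) + 1) - 1 / (2 * t n)"
proof -
  obtain a b c where N: "N n = (a, b, c)" by (cases "N n")
  have "0 < a" "0 < b" using N_invariant[OF assms] by (simp_all add: N)
  then show ?thesis
    using assms N_left[OF assms]
    by (auto simp: t_def a_seq_def b_seq_def c_seq_def N field_simps elim!: evenE)
qed

lemma t_middle:
  assumes "n \<ge> 1"
  shows "t (3 * n) = t n / (2 * t n + 1)"
proof -
  obtain a b c where N: "N n = (a, b, c)" by (cases "N n")
  have "0 < a" "0 < b" using N_invariant[OF assms] by (simp_all add: N)
  then have "0 < 2 * real_of_int a + real_of_int b" by simp
  with \<open>0 < b\<close> show ?thesis
    using assms N_middle[OF assms]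
    by (simp add: t_def a_seq_def b_seq_def N field_simps)
qed

text \<open>
  Index \<open>0\<close> is included: with \<open>t 0 = 0\<close> the top behaves like the right child of a vertex \<open>0\<close>.
\<close>

lemma t_right: "t (3 * n + 1) = (2 * t n + 1) / (2 * (t n + 1))"
proof (cases "n = 0")
  case True
  then show ?thesis by (simp add: t_def a_seq_def b_seq_def N_1[simplified])
next
  case False
  then have n: "n \<ge> 1" by simp
  obtain a b c where N: "N n = (a, b, c)" by (cases "N n")
  have "0 < a" "0 < b" using N_invariant[OF n] by (simp_all add: N)
  have "2 * t n + 1 = (2 * real_of_int a + real_of_int b) / real_of_int b"
    "2 * (t n + 1) = 2 * (real_of_int a + real_of_int b) / real_of_int b"
    using n \<open>0 < b\<close> by (simp_all add: t_def a_seq_def b_seq_def N field_simps)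
  then have "(2 * t n + 1) / (2 * (t n + 1))
      = (2 * real_of_int a + real_of_int b) / (2 * (real_of_int a + real_of_int b))"
    using \<open>0 < b\<close> by simp
  moreover have "t (3 * n + 1)
      = (2 * real_of_int a + real_of_int b) / (2 * (real_of_int a + real_of_int b))"
  proof (cases "odd b")
    case True
    then show ?thesis using N_right[OF n] by (simp add: t_def a_seq_def b_seq_def N)
  next
    case False
    then obtain d where d: "b = 2 * d" by (auto elim: evenE)
    have "t (3 * n + 1) = (real_of_int a + real_of_int d) / (real_of_int a + real_of_int b)"
      using N_right[OF n] by (simp add: t_def a_seq_def b_seq_def N d)
    also have "\<dots> = 2 * (real_of_int a + real_of_int d) / (2 * (real_of_int a + real_of_int b))"
      by (rule mult_divide_mult_cancel_left[symmetric]) simp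
    finally show ?thesis by (simp add: d)
  qed
  ultimately show ?thesis by simp
qed

text \<open>
  The step from the right child of \<open>k\<close> to the left child of \<open>k + 1\<close> compares neighbours with
  different parents, so it needs the relation between \<open>t k\<close> and \<open>t (k + 1)\<close>: hence the strong
  induction.
\<close>

lemma t_Suc:
  "t (Suc n) = 1 / (2 * (1 + 2 * real_of_int \<lfloor>t n\<rfloor> - t n))"
proof (induction n rule: less_induct)
  case (less n)
  consider (zero) "n = 0" | (left) k where "k \<ge> 1" "n = 3 * k - 1"
    | (middle) k where "k \<ge> 1" "n = 3 * k" | (right) k where "n = 3 * k + 1"
  proof -
    have "n = 0 \<or> (n = 3 * ((n + 1) div 3) - 1 \<and> 1 \<le> (n + 1) div 3)
      \<or> (n = 3 * (n div 3) \<and> 1 \<le> n div 3) \<or> n = 3 * (n div 3) + 1"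
      by presburger
    then show ?thesis using that by metis
  qed
  then show ?case
  proof cases
    case zero
    then show ?thesis using t_right[of 0] by (simp add: t_def)
  next
    case (left k)
    note bounds = c_seq_bounds[OF left(1)]
    have n: "t n = 2 * (real_of_int (c_seq k) + 1) - 1 / (2 * t k)"
      unfolding left(2) by (rule t_left[OF left(1)])
    have "\<lfloor>t n\<rfloor> = c_seq k + 1"
      using bounds by (intro floor_unique) (simp_all add: n)
    then have "1 + 2 * real_of_int \<lfloor>t n\<rfloor> - t n = 1 + 1 / (2 * t k)"
      by (simp add: n)
    moreover have "t k / (2 * t k + 1) = 1 / (2 * (1 + 1 / (2 * t k)))"
      using t_pos[OF left(1)] by (simp add: field_simps)
    moreover have "Suc n = 3 * k" using left by simp
    ultimately show ?thesis
      using t_middle[OF left(1)] by simp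
  next
    case (middle k)
    have n: "t n = t k / (2 * t k + 1)"
      unfolding middle(2) by (rule t_middle[OF middle(1)])
    have pos: "0 < t k" using t_pos[OF middle(1)] .
    have "\<lfloor>t n\<rfloor> = 0"
      using pos by (intro floor_unique) (simp_all add: n)
    moreover have "(2 * t k + 1) / (2 * (t k + 1)) = 1 / (2 * (1 - t n))"
      using pos by (simp add: n field_simps)
    moreover have "Suc n = 3 * k + 1" using middle by simp
    ultimately show ?thesis
      using t_right[of k] by simp
  next
    case (right k)
    have nonneg: "0 \<le> t k" by (rule t_nonneg)
    have n: "t n = (2 * t k + 1) / (2 * (t k + 1))"
      unfolding right by (rule t_right)
    have "\<lfloor>t n\<rfloor> = 0"
      using nonneg by (intro floor_unique) (simp_all add: n)
    moreover have "1 - t n = 1 / (2 * (t k + 1))"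
      using nonneg by (simp add: n field_simps)
    ultimately have image: "1 / (2 * (1 + 2 * real_of_int \<lfloor>t n\<rfloor> - t n)) = t k + 1"
      by simp
    have "k < n" using right by simp
    from less.IH[OF this]
    have inverse_t: "1 / (2 * t (Suc k)) = 1 + 2 * real_of_int \<lfloor>t k\<rfloor> - t k"
      by simp
    \<comment> \<open>The bounds on \<open>c\<close> at \<open>k + 1\<close> put the integer \<open>2 * \<lfloor>t k\<rfloor> - c\<close> into the half-open
      interval \<open>(t k - 1, t k]\<close>, whose only integer is \<open>\<lfloor>t k\<rfloor>\<close>.\<close>
    have "2 * \<lfloor>t k\<rfloor> - c_seq (Suc k) = \<lfloor>t k\<rfloor>"
      using c_seq_bounds[of "Suc k"] unfolding inverse_t by linarith
    then have c: "c_seq (Suc k) = \<lfloor>t k\<rfloor>" by simp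
    have "Suc n = 3 * Suc k - 1" using right by simp
    then have "t (Suc n) = t k + 1"
      using t_left[of "Suc k"] unfolding inverse_t c by simp
    then show ?thesis unfolding image .
  qed
qed

theorem corollary3:
  fixes f :: "real \<Rightarrow> real"
  assumes f_eq: "\<And>x. x \<ge> 0 \<Longrightarrow> f x = 1 / (1 + 2 * real_of_int \<lfloor>x\<rfloor> - x)"
  shows "t 0 = 0 \<and>
    (\<forall>n\<ge>1. t n = 1 / (2 * (1 + 2 * real_of_int \<lfloor>t (n - 1)\<rfloor> - t (n - 1))) \<and>
            t n = f (t (n - 1)) / 2)"
proof (intro conjI allI impI)
  show "t 0 = 0" by (simp add: t_def)
next
  fix n :: nat
  assume "n \<ge> 1"
  then show step: "t n = 1 / (2 * (1 + 2 * real_of_int \<lfloor>t (n - 1)\<rfloor> - t (n - 1)))"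
    using t_Suc[of "n - 1"] by simp
  show "t n = f (t (n - 1)) / 2"
    unfolding f_eq[OF t_nonneg] by (subst step) simp
qed

end
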